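(* Let $(\Omega,\mathcal F,\mathsf P)$ be a probability space and let $(X_n)_{n\in\mathbb N}$ be a sequence of i.i.d. integrable random variables on it with $\mathsf E_{\mathsf P}[X_1]=0$. Let $S_n:=\sum_{i=1}^n X_i$, let $q\in[1,2)$, and define $$\mathsf U^{(q)}_{\mathsf P}(x):=\mathsf E_{\mathsf P}\big[|X_1|^q\mathbf 1\{|X_1|^q\ge x\}\big],\qquad x\ge 0.$$ Then for any $\varepsilon>0$ and $m\in\mathbb N$, $$\mathsf P\left[\sup_{k\ge m}\frac{|S_k|}{k^{1/q}}\ge\varepsilon\right]\le\frac{4\exp\left(-m^{1/q-1/2}\right)}{2-q}+\frac{451\,q}{(\varepsilon^2\wedge 1)(2-q)}\,\mathsf U^{(q)}_{\mathsf P}\left(\varepsilon^q\,\frac{m^{1/2-q/4}}{38}\right).$$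
   Context: $\mathbb N=\{1,2,\dots\}$; $a\wedge b=\min(a,b)$; random variables are real-valued; $\mathsf E_{\mathsf P}$ denotes expectation under $\mathsf P$. The quantity $\mathsf U^{(q)}_{\mathsf P}(x)\in[0,\infty]$ may be infinite (in which case the bound is trivial). *)

theory Defs
  imports "HOL-Probability.Probability"
begin

text \<open>The value is taken in \<open>[0, \<infinity>]\<close>, so no finiteness of the \<open>q\<close>-th absolute moment is presupposed.\<close>

definition tail_moment :: "'a measure \<Rightarrow> ('a \<Rightarrow> real) \<Rightarrow> real \<Rightarrow> real \<Rightarrow> ennreal" where
  "tail_moment M Y q x =
     (\<integral>\<^sup>+ \<omega> \<in> {\<omega> \<in> space M. \<bar>Y \<omega>\<bar> powr q \<ge> x}. ennreal (\<bar>Y \<omega>\<bar> powr q) \<partial>M)"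

end

theory Submission
  imports Defs
begin

text \<open>
  Dividing the variables by \<open>\<epsilon>\<close> reduces the statement to \<open>\<epsilon> = 1\<close>: the truncated moment in the claim
  is \<open>\<epsilon> powr q\<close> times the one of the scaled variable, and \<open>\<epsilon> powr q\<close> is at least \<open>min (\<epsilon>\<^sup>2) 1\<close>. Write
  \<open>\<tau> = m powr (1/2 - q/4) / 38\<close> and let \<open>u\<close> be the truncated moment of the scaled variable at \<open>\<tau>\<close>.
  If \<open>u\<close> exceeds \<open>1/8\<close>, the second summand of the bound already exceeds \<open>1\<close>, so \<open>u \<le> 1/8\<close> may be
  assumed.

  Each variable \<open>X i\<close> is split into three parts according to the size of \<open>\<bar>X i\<bar> powr q\<close>: a light part
  where it lies below \<open>\<tau>\<close>, a middle part where it lies between \<open>\<tau>\<close> and \<open>i\<close>, and a heavy part where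
  it exceeds both. Each part is centred by its own mean; the three means add up to zero because
  \<open>X i\<close> is centred.

  \<^item> The light part is bounded by \<open>\<tau> powr (1/q)\<close>, so its partial sums are sub-Gaussian with a
    variance proxy of order \<open>m powr (1/q - 1/2)\<close> per summand. On the dyadic block
    \<open>n \<le> k \<le> 2 n\<close> with \<open>n = 2 ^ j * m\<close>, the maximal Hoeffding inequality gives a deviation
    probability of at most \<open>2 * exp (- 2 * 2 powr (t * j) * m powr (1/q - 1/2))\<close> with \<open>t = 2/q - 1\<close>,
    and these terms add up to at most \<open>2 * exp (- (m powr (1/q - 1/2))) / t\<close>, where
    \<open>1/t = q/(2 - q)\<close>. This is the exponential term.
  \<^item> The middle part is square integrable, and Kolmogorov's maximal inequality on the same
    blocks bounds its deviation probabilities. Summing over the blocks and exchanging sum and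
    expectation leaves, for each value \<open>x\<close>, the geometric sum of \<open>n powr (- t)\<close> over the blocks with
    \<open>\<bar>x\<bar> powr q \<le> 2 n\<close>; multiplied by \<open>x\<^sup>2\<close> this is of order \<open>\<bar>x\<bar> powr q / t\<close>.
  \<^item> The heavy part vanishes for all \<open>i\<close> at once outside an event of probability at most \<open>u\<close>,
    because the number of \<open>i \<ge> 1\<close> below \<open>\<bar>x\<bar> powr q\<close> is at most \<open>\<bar>x\<bar> powr q\<close>. Its means up to \<open>k\<close>
    add up to at most \<open>k powr (1/q) * u\<close>.

  Allotting the shares \<open>1/2\<close>, \<open>1/4\<close> and \<open>1/8\<close> of \<open>k powr (1/q)\<close> to the three parts controls the event
  that some normalised partial sum exceeds \<open>7/8\<close>. A supremum of at least \<open>1\<close> forces that event even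
  if the supremum is not attained.

  Both maximal inequalities are instances of \<open>maximal_inequality\<close>, a Doob inequality for convex
  functions of sums of bounded independent centred variables; the three parts are put together
  in \<open>normalised_maximal_inequality\<close>.
\<close>

section \<open>Maximal inequalities for bounded independent variables\<close>

context prob_space
begin

text \<open>
  Restricting the family to \<open>{1..k}\<close> makes the past one random variable with values in a product
  space, independent of any later variable. This replaces the martingale property in the maximal
  inequality below, and it removes the cross terms in the variance of a sum.
\<close>

lemma past_orthogonal_to_future:
  fixes Y :: "nat \<Rightarrow> 'a \<Rightarrow> real"
  assumes indep: "indep_vars (\<lambda>_. borel) Y {1..n}"
    and int: "\<And>i. i \<in> {1..n} \<Longrightarrow> integrable M (Y i)"
    and mean: "\<And>i. i \<in> {1..n} \<Longrightarrow> expectation (Y i) = 0"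
    and i: "k < i" "i \<le> n"
    and h: "h \<in> borel_measurable (PiM {1..k} (\<lambda>_. borel))"
    and int_h: "integrable M (\<lambda>\<omega>. h (\<lambda>j\<in>{1..k}. Y j \<omega>))"
  shows "integrable M (\<lambda>\<omega>. h (\<lambda>j\<in>{1..k}. Y j \<omega>) * Y i \<omega>)"
    and "expectation (\<lambda>\<omega>. h (\<lambda>j\<in>{1..k}. Y j \<omega>) * Y i \<omega>) = 0"
proof -
  have "indep_var borel (h \<circ> (\<lambda>\<omega>. \<lambda>j\<in>{1..k}. Y j \<omega>)) borel ((\<lambda>v. v i) \<circ> (\<lambda>\<omega>. \<lambda>j\<in>{i}. Y j \<omega>))"
    using i by (intro indep_var_compose[OF indep_var_restrict[OF indep] h]) auto
  then have ind: "indep_var borel (\<lambda>\<omega>. h (\<lambda>j\<in>{1..k}. Y j \<omega>)) borel (Y i)"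
    by (simp add: comp_def)
  have int_i: "integrable M (Y i)"
    using int i by simp
  show "integrable M (\<lambda>\<omega>. h (\<lambda>j\<in>{1..k}. Y j \<omega>) * Y i \<omega>)"
    using indep_var_integrable[OF ind int_h int_i] .
  show "expectation (\<lambda>\<omega>. h (\<lambda>j\<in>{1..k}. Y j \<omega>) * Y i \<omega>) = 0"
    using indep_var_lebesgue_integral[OF ind int_h int_i] mean[of i] i by simp
qed

text \<open>
  Doob's maximal inequality. On the event that \<open>k\<close> is the first index with \<open>f (S k) \<ge> c\<close>, the
  tangent of \<open>f\<close> at \<open>S k\<close> bounds \<open>f (S n)\<close> from below by \<open>c\<close> plus a function of the past times the
  increment \<open>S n - S k\<close>, and this product has mean zero. Summing over the disjoint events gives the
  claim. Convexity enters only through the tangents, whose slopes are given by \<open>g\<close>; boundedness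
  settles every integrability question.
\<close>

lemma maximal_inequality:
  fixes Y :: "nat \<Rightarrow> 'a \<Rightarrow> real" and f g :: "real \<Rightarrow> real"
  assumes indep: "indep_vars (\<lambda>_. borel) Y {1..n}"
    and bounded: "\<And>i \<omega>. i \<in> {1..n} \<Longrightarrow> \<omega> \<in> space M \<Longrightarrow> \<bar>Y i \<omega>\<bar> \<le> B"
    and mean: "\<And>i. i \<in> {1..n} \<Longrightarrow> expectation (Y i) = 0"
    and cont: "continuous_on UNIV f" "continuous_on UNIV g"
    and nonneg: "\<And>x. 0 \<le> f x"
    and subgradient: "\<And>x y. f x + g x * (y - x) \<le> f y"
  shows "c * prob {\<omega> \<in> space M. \<exists>k\<in>{1..n}. c \<le> f (\<Sum>i=1..k. Y i \<omega>)}
    \<le> expectation (\<lambda>\<omega>. f (\<Sum>i=1..n. Y i \<omega>))"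
proof -
  define S where "S k \<omega> = (\<Sum>i=1..k. Y i \<omega>)" for k \<omega>
  have meas_Y: "Y i \<in> borel_measurable M" if "i \<in> {1..n}" for i
    using indep that by (auto simp: indep_vars_def)
  have meas_S: "S k \<in> borel_measurable M" if "k \<le> n" for k
    unfolding S_def by (intro borel_measurable_sum meas_Y) (use that in auto)
  have meas_f [measurable]: "f \<in> borel_measurable borel" and meas_g [measurable]: "g \<in> borel_measurable borel"
    using cont by (auto intro: borel_measurable_continuous_onI)
  have int_Y: "integrable M (Y i)" if "i \<in> {1..n}" for i
    by (rule integrable_const_bound[where B = B]) (use that bounded meas_Y in auto)
  have S_bound: "S k \<omega> \<in> {- (real n * \<bar>B\<bar>)..real n * \<bar>B\<bar>}" if "\<omega> \<in> space M" "k \<le> n" for k \<omega>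
  proof -
    have "\<bar>S k \<omega>\<bar> \<le> (\<Sum>i=1..k. \<bar>Y i \<omega>\<bar>)"
      unfolding S_def by (rule sum_abs)
    also have "\<dots> \<le> (\<Sum>i=1..k. \<bar>B\<bar>)"
    proof (intro sum_mono)
      fix i assume "i \<in> {1..k}"
      then show "\<bar>Y i \<omega>\<bar> \<le> \<bar>B\<bar>"
        using bounded[of i \<omega>] that by auto
    qed
    also have "\<dots> \<le> real n * \<bar>B\<bar>"
      using that by (auto intro!: mult_right_mono)
    finally show ?thesis by auto
  qed
  have bdd: "\<exists>C. \<forall>k\<le>n. \<forall>\<omega>\<in>space M. \<bar>\<phi> (S k \<omega>)\<bar> \<le> C" if "continuous_on UNIV \<phi>" for \<phi> :: "real \<Rightarrow> real"
  proof -
    have "compact (\<phi> ` {- (real n * \<bar>B\<bar>)..real n * \<bar>B\<bar>})"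
      by (intro compact_continuous_image continuous_on_subset[OF that]) auto
    then obtain C where "\<forall>y\<in>\<phi> ` {- (real n * \<bar>B\<bar>)..real n * \<bar>B\<bar>}. \<bar>y\<bar> \<le> C"
      using compact_imp_bounded by (fastforce simp: bounded_iff)
    then show ?thesis
      using S_bound by (intro exI[of _ C]) blast
  qed
  obtain F where F: "\<And>k \<omega>. k \<le> n \<Longrightarrow> \<omega> \<in> space M \<Longrightarrow> \<bar>f (S k \<omega>)\<bar> \<le> F"
    using bdd[OF cont(1)] by blast
  obtain G where G: "\<And>k \<omega>. k \<le> n \<Longrightarrow> \<omega> \<in> space M \<Longrightarrow> \<bar>g (S k \<omega>)\<bar> \<le> G"
    using bdd[OF cont(2)] by blast
  \<comment> \<open>the threshold \<open>c\<close> is reached for the first time at \<open>k\<close>\<close>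
  define A where "A k = {\<omega> \<in> space M. c \<le> f (S k \<omega>) \<and> (\<forall>j\<in>{1..<k}. f (S j \<omega>) < c)}" for k
  have A_sets [measurable]: "A k \<in> sets M" if "k \<le> n" for k
  proof -
    have [measurable]: "S j \<in> borel_measurable M" if "j \<in> {1..<k}" for j
      using that \<open>k \<le> n\<close> by (intro meas_S) auto
    have [measurable]: "S k \<in> borel_measurable M"
      using \<open>k \<le> n\<close> by (rule meas_S)
    show ?thesis unfolding A_def by measurable
  qed
  have disj: "disjoint_family_on A {1..n}"
    unfolding disjoint_family_on_def
  proof (intro ballI impI)
    fix j k assume "j \<in> {1..n}" "k \<in> {1..n}" "j \<noteq> k"
    then show "A j \<inter> A k = {}"
      by (cases "j < k") (force simp: A_def)+
  qed
  have cover: "{\<omega> \<in> space M. \<exists>k\<in>{1..n}. c \<le> f (S k \<omega>)} = (\<Union>k\<in>{1..n}. A k)"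
  proof (intro subset_antisym subsetI)
    fix \<omega> assume "\<omega> \<in> {\<omega> \<in> space M. \<exists>k\<in>{1..n}. c \<le> f (S k \<omega>)}"
    then have \<omega>: "\<omega> \<in> space M" and ex: "\<exists>k. k \<in> {1..n} \<and> c \<le> f (S k \<omega>)" by auto
    define k where "k = (LEAST k. k \<in> {1..n} \<and> c \<le> f (S k \<omega>))"
    have k: "k \<in> {1..n}" "c \<le> f (S k \<omega>)"
      using LeastI_ex[OF ex] by (auto simp: k_def)
    have "f (S j \<omega>) < c" if "j \<in> {1..<k}" for j
      using not_less_Least[of j "\<lambda>k. k \<in> {1..n} \<and> c \<le> f (S k \<omega>)"] that k by (auto simp: k_def)
    with k \<omega> show "\<omega> \<in> (\<Union>k\<in>{1..n}. A k)" by (auto simp: A_def)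
  qed (auto simp: A_def)
  have int_f: "integrable M (\<lambda>\<omega>. f (S n \<omega>))"
    by (rule integrable_const_bound[where B = F]) (use F meas_S in auto)
  have int_fA: "integrable M (\<lambda>\<omega>. f (S n \<omega>) * indicator (A k) \<omega>)" if "k \<in> {1..n}" for k
    using that by (intro integrable_real_mult_indicator int_f A_sets) auto
  have step: "c * prob (A k) \<le> expectation (\<lambda>\<omega>. f (S n \<omega>) * indicator (A k) \<omega>)" if k: "k \<in> {1..n}" for k
  proof -
    \<comment> \<open>\<open>g (S k)\<close> on \<open>A k\<close> and zero elsewhere, written as a function of the first \<open>k\<close> variables\<close>
    define h where "h v = g (\<Sum>i=1..k. v i) *
      (if c \<le> f (\<Sum>i=1..k. v i) \<and> (\<forall>j\<in>{1..<k}. f (\<Sum>i=1..j. v i) < c) then 1 else 0)"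
      for v :: "nat \<Rightarrow> real"
    have [measurable]: "(\<lambda>v. \<Sum>i=1..j. v i) \<in> borel_measurable (PiM {1..k} (\<lambda>_. borel :: real measure))" if "j \<le> k" for j
      by (intro borel_measurable_sum measurable_component_singleton) (use that in auto)
    have h: "h \<in> borel_measurable (PiM {1..k} (\<lambda>_. borel))"
      unfolding h_def by measurable
    have h_eq: "h (\<lambda>j\<in>{1..k}. Y j \<omega>) = g (S k \<omega>) * indicator (A k) \<omega>" if "\<omega> \<in> space M" for \<omega>
    proof -
      have "(\<Sum>i=1..j. (\<lambda>j\<in>{1..k}. Y j \<omega>) i) = S j \<omega>" if "j \<le> k" for j
        unfolding S_def by (rule sum.cong) (use that in auto)
      then show ?thesis
        using that by (auto simp: h_def A_def indicator_def)
    qed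
    have "norm (h (\<lambda>j\<in>{1..k}. Y j \<omega>)) \<le> G" if "\<omega> \<in> space M" for \<omega>
      using h_eq[OF that] G[of k \<omega>] that k by (auto simp: indicator_def)
    then have int_h: "integrable M (\<lambda>\<omega>. h (\<lambda>j\<in>{1..k}. Y j \<omega>))"
      by (intro integrable_const_bound[where B = G] measurable_compose[OF _ h] measurable_restrict meas_Y AE_I2)
        (use k in auto)
    note orth = past_orthogonal_to_future[OF indep int_Y mean _ _ h int_h]
    have int_A: "integrable M (\<lambda>\<omega>. c * indicator (A k) \<omega>)"
      using A_sets[of k] k by (auto intro!: integrable_mult_right integrable_real_indicator simp: emeasure_eq_measure)
    have int_future: "integrable M (\<lambda>\<omega>. \<Sum>i\<in>{k<..n}. h (\<lambda>j\<in>{1..k}. Y j \<omega>) * Y i \<omega>)"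
      by (intro Bochner_Integration.integrable_sum orth(1)) auto
    have "expectation (\<lambda>\<omega>. \<Sum>i\<in>{k<..n}. h (\<lambda>j\<in>{1..k}. Y j \<omega>) * Y i \<omega>)
      = (\<Sum>i\<in>{k<..n}. expectation (\<lambda>\<omega>. h (\<lambda>j\<in>{1..k}. Y j \<omega>) * Y i \<omega>))"
      by (intro Bochner_Integration.integral_sum orth(1)) auto
    also have "\<dots> = 0"
      by (intro sum.neutral ballI orth(2)) auto
    finally have future: "expectation (\<lambda>\<omega>. \<Sum>i\<in>{k<..n}. h (\<lambda>j\<in>{1..k}. Y j \<omega>) * Y i \<omega>) = 0" .
    have "c * prob (A k) = expectation (\<lambda>\<omega>. c * indicator (A k) \<omega>)"
      using A_sets[of k] k by simp
    also have "\<dots> = expectation (\<lambda>\<omega>. c * indicator (A k) \<omega> + (\<Sum>i\<in>{k<..n}. h (\<lambda>j\<in>{1..k}. Y j \<omega>) * Y i \<omega>))"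
      using int_A int_future future by simp
    also have "\<dots> \<le> expectation (\<lambda>\<omega>. f (S n \<omega>) * indicator (A k) \<omega>)"
    proof (intro integral_mono Bochner_Integration.integrable_add Bochner_Integration.integrable_sum int_A int_fA k)
      fix i assume "i \<in> {k<..n}"
      then show "integrable M (\<lambda>\<omega>. h (\<lambda>j\<in>{1..k}. Y j \<omega>) * Y i \<omega>)"
        by (intro orth(1)) auto
    next
      fix \<omega> assume \<omega>: "\<omega> \<in> space M"
      have split: "{1..n} = {1..k} \<union> {k<..n}" "{1..k} \<inter> {k<..n} = {}"
        using k by auto
      have "S n \<omega> - S k \<omega> = (\<Sum>i\<in>{k<..n}. Y i \<omega>)"
        unfolding S_def split(1) by (subst sum.union_disjoint) (use split in auto)
      then show "c * indicator (A k) \<omega> + (\<Sum>i\<in>{k<..n}. h (\<lambda>j\<in>{1..k}. Y j \<omega>) * Y i \<omega>)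
        \<le> f (S n \<omega>) * indicator (A k) \<omega>"
        using subgradient[of "S k \<omega>" "S n \<omega>"] h_eq[OF \<omega>]
        by (auto simp: indicator_def A_def simp flip: sum_distrib_left)
    qed
    finally show ?thesis .
  qed
  have "c * prob (\<Union>k\<in>{1..n}. A k) = (\<Sum>k\<in>{1..n}. c * prob (A k))"
    using A_sets disj by (subst finite_measure_finite_Union) (auto simp: sum_distrib_left)
  also have "\<dots> \<le> (\<Sum>k\<in>{1..n}. expectation (\<lambda>\<omega>. f (S n \<omega>) * indicator (A k) \<omega>))"
    by (intro sum_mono step)
  also have "\<dots> = expectation (\<lambda>\<omega>. \<Sum>k\<in>{1..n}. f (S n \<omega>) * indicator (A k) \<omega>)"
    by (rule Bochner_Integration.integral_sum[symmetric]) (rule int_fA)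
  also have "\<dots> \<le> expectation (\<lambda>\<omega>. f (S n \<omega>))"
  proof (intro integral_mono Bochner_Integration.integrable_sum int_fA int_f)
    fix \<omega>
    have "(\<Sum>k\<in>{1..n}. f (S n \<omega>) * indicator (A k) \<omega>) = f (S n \<omega>) * indicator (\<Union>k\<in>{1..n}. A k) \<omega>"
      unfolding indicator_UN_disjoint[OF finite_atLeastAtMost disj] sum_distrib_left ..
    also have "\<dots> \<le> f (S n \<omega>)"
      using nonneg by (simp add: indicator_def)
    finally show "(\<Sum>k\<in>{1..n}. f (S n \<omega>) * indicator (A k) \<omega>) \<le> f (S n \<omega>)" .
  qed simp
  finally show ?thesis
    using cover by (simp add: S_def)
qed

lemma expectation_exp_sum_le:
  fixes Y :: "nat \<Rightarrow> 'a \<Rightarrow> real"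
  assumes indep: "indep_vars (\<lambda>_. borel) Y {1..n}"
    and range: "\<And>i \<omega>. i \<in> {1..n} \<Longrightarrow> \<omega> \<in> space M \<Longrightarrow> Y i \<omega> \<in> {a..a + 2 * b}"
    and mean: "\<And>i. i \<in> {1..n} \<Longrightarrow> expectation (Y i) = 0"
    and l: "l > 0"
  shows "integrable M (\<lambda>\<omega>. exp (l * (\<Sum>i=1..n. Y i \<omega>)))"
    and "expectation (\<lambda>\<omega>. exp (l * (\<Sum>i=1..n. Y i \<omega>))) \<le> exp (real n * (l\<^sup>2 * b\<^sup>2 / 2))"
proof -
  have meas: "Y i \<in> borel_measurable M" if "i \<in> {1..n}" for i
    using indep that by (auto simp: indep_vars_def)
  have int: "integrable M (\<lambda>\<omega>. exp (l * Y i \<omega>))" if i: "i \<in> {1..n}" for i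
  proof (rule integrable_const_bound[where B = "exp (l * (a + 2 * b))"])
    show "(\<lambda>\<omega>. exp (l * Y i \<omega>)) \<in> borel_measurable M"
      using meas[OF i] by measurable
  qed (use range[OF i] l in auto)
  have ind: "indep_vars (\<lambda>_. borel) (\<lambda>i \<omega>. exp (l * Y i \<omega>)) {1..n}"
    by (rule indep_vars_compose2[OF indep]) measurable
  have prod: "exp (l * (\<Sum>i=1..n. Y i \<omega>)) = (\<Prod>i=1..n. exp (l * Y i \<omega>))" for \<omega>
    by (simp add: sum_distrib_left exp_sum)
  show "integrable M (\<lambda>\<omega>. exp (l * (\<Sum>i=1..n. Y i \<omega>)))"
    unfolding prod by (rule indep_vars_integrable) (use ind int in auto)
  have one: "expectation (\<lambda>\<omega>. exp (l * Y i \<omega>)) \<le> exp (l\<^sup>2 * b\<^sup>2 / 2)" if i: "i \<in> {1..n}" for i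
  proof -
    interpret interval_bounded_random_variable M "Y i" a "a + 2 * b"
      by unfold_locales (use meas[OF i] range[OF i] in auto)
    have "ennreal (expectation (\<lambda>\<omega>. exp (l * Y i \<omega>))) = (\<integral>\<^sup>+ \<omega>. exp (l * Y i \<omega>) \<partial>M)"
      using int[OF i] by (intro nn_integral_eq_integral[symmetric]) auto
    also have "\<dots> \<le> ennreal (exp (l\<^sup>2 * (a + 2 * b - a)\<^sup>2 / 8))"
      by (rule Hoeffdings_lemma_nn_integral_0[OF l mean[OF i]])
    finally show ?thesis
      by (simp add: power_mult_distrib mult.commute)
  qed
  have "expectation (\<lambda>\<omega>. exp (l * (\<Sum>i=1..n. Y i \<omega>))) = (\<Prod>i=1..n. expectation (\<lambda>\<omega>. exp (l * Y i \<omega>)))"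
    unfolding prod by (rule indep_vars_lebesgue_integral) (use ind int in auto)
  also have "\<dots> \<le> (\<Prod>i=1..n. exp (l\<^sup>2 * b\<^sup>2 / 2))"
    using one by (intro prod_mono) auto
  also have "\<dots> = exp (real n * (l\<^sup>2 * b\<^sup>2 / 2))"
    by (subst exp_of_nat_mult) simp
  finally show "expectation (\<lambda>\<omega>. exp (l * (\<Sum>i=1..n. Y i \<omega>))) \<le> exp (real n * (l\<^sup>2 * b\<^sup>2 / 2))" .
qed

text \<open>
  The maximal inequality for \<open>exp (l s) + exp (- l s)\<close>, a convex function that treats both tails at
  once and costs the factor \<open>2\<close>. By Hoeffding's lemma its expectation is at most
  \<open>2 * exp (n * l\<^sup>2 * b\<^sup>2 / 2)\<close>.
\<close>

lemma maximal_Hoeffding: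
  fixes Y :: "nat \<Rightarrow> 'a \<Rightarrow> real"
  assumes indep: "indep_vars (\<lambda>_. borel) Y {1..n}"
    and range: "\<And>i \<omega>. i \<in> {1..n} \<Longrightarrow> \<omega> \<in> space M \<Longrightarrow> Y i \<omega> \<in> {a..a + 2 * b}"
    and mean: "\<And>i. i \<in> {1..n} \<Longrightarrow> expectation (Y i) = 0"
    and pos: "b > 0" "x > 0" "n > 0"
  shows "prob {\<omega> \<in> space M. \<exists>k\<in>{1..n}. x \<le> \<bar>\<Sum>i=1..k. Y i \<omega>\<bar>}
    \<le> 2 * exp (- (x\<^sup>2 / (2 * real n * b\<^sup>2)))"
proof -
  \<comment> \<open>the minimiser of \<open>n * l\<^sup>2 * b\<^sup>2 / 2 - l * x\<close>\<close>
  define l where "l = x / (real n * b\<^sup>2)"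
  have l: "l > 0"
    using pos by (simp add: l_def)
  define f where "f s = exp (l * s) + exp (- (l * s))" for s :: real
  define g where "g s = l * (exp (l * s) - exp (- (l * s)))" for s :: real
  have exp_tangent: "exp u + exp u * (v - u) \<le> exp v" for u v :: real
    using mult_left_mono[OF exp_ge_add_one_self[of "v - u"], of "exp u"]
    by (simp add: algebra_simps flip: exp_add)
  have subgradient: "f s + g s * (y - s) \<le> f y" for s y
    using exp_tangent[of "l * s" "l * y"] exp_tangent[of "- (l * s)" "- (l * y)"]
    unfolding f_def g_def by (simp add: algebra_simps)
  have meas: "Y i \<in> borel_measurable M" if "i \<in> {1..n}" for i
    using indep that by (auto simp: indep_vars_def)
  note upper = expectation_exp_sum_le[OF indep range mean l]
  have ind': "indep_vars (\<lambda>_. borel) (\<lambda>i \<omega>. - Y i \<omega>) {1..n}"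
    by (rule indep_vars_compose2[OF indep]) measurable
  have range': "- Y i \<omega> \<in> {- (a + 2 * b)..- (a + 2 * b) + 2 * b}" if "i \<in> {1..n}" "\<omega> \<in> space M" for i \<omega>
    using range[OF that] by auto
  have mean': "expectation (\<lambda>\<omega>. - Y i \<omega>) = 0" if "i \<in> {1..n}" for i
    using mean[OF that] by simp
  note lower = expectation_exp_sum_le[OF ind' range' mean' l, unfolded sum_negf mult_minus_right]
  have [measurable]: "(\<lambda>\<omega>. \<Sum>i=1..k. Y i \<omega>) \<in> borel_measurable M" if "k \<in> {1..n}" for k
    by (intro borel_measurable_sum meas) (use that in auto)
  have "exp (l * x) * prob {\<omega> \<in> space M. \<exists>k\<in>{1..n}. x \<le> \<bar>\<Sum>i=1..k. Y i \<omega>\<bar>}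
    \<le> exp (l * x) * prob {\<omega> \<in> space M. \<exists>k\<in>{1..n}. exp (l * x) \<le> f (\<Sum>i=1..k. Y i \<omega>)}"
  proof (intro mult_left_mono finite_measure_mono)
    show "{\<omega> \<in> space M. \<exists>k\<in>{1..n}. exp (l * x) \<le> f (\<Sum>i=1..k. Y i \<omega>)} \<in> events"
      unfolding f_def by measurable
    have "exp (l * x) \<le> f s" if "x \<le> \<bar>s\<bar>" for s
    proof -
      have "exp (l * x) \<le> exp (l * \<bar>s\<bar>)"
        using l that by simp
      also have "\<dots> \<le> f s"
        by (cases "s \<ge> 0") (auto simp: f_def)
      finally show ?thesis .
    qed
    then show "{\<omega> \<in> space M. \<exists>k\<in>{1..n}. x \<le> \<bar>\<Sum>i=1..k. Y i \<omega>\<bar>}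
      \<subseteq> {\<omega> \<in> space M. \<exists>k\<in>{1..n}. exp (l * x) \<le> f (\<Sum>i=1..k. Y i \<omega>)}"
      by blast
  qed simp
  also have "\<dots> \<le> expectation (\<lambda>\<omega>. f (\<Sum>i=1..n. Y i \<omega>))"
  proof (rule maximal_inequality[OF indep _ mean _ _ _ subgradient])
    show "\<bar>Y i \<omega>\<bar> \<le> \<bar>a\<bar> + 2 * b" if "i \<in> {1..n}" "\<omega> \<in> space M" for i \<omega>
      using range[OF that] pos by auto
    show "continuous_on UNIV f" "continuous_on UNIV g"
      unfolding f_def g_def by (auto intro!: continuous_intros)
    show "0 \<le> f s" for s
      by (simp add: f_def)
  qed
  also have "\<dots> \<le> 2 * exp (real n * (l\<^sup>2 * b\<^sup>2 / 2))"
    unfolding f_def using upper lower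
    by (subst Bochner_Integration.integral_add) auto
  finally have "prob {\<omega> \<in> space M. \<exists>k\<in>{1..n}. x \<le> \<bar>\<Sum>i=1..k. Y i \<omega>\<bar>}
    \<le> 2 * exp (real n * (l\<^sup>2 * b\<^sup>2 / 2) - l * x)"
    by (simp add: exp_diff pos_le_divide_eq mult.commute)
  also have "real n * (l\<^sup>2 * b\<^sup>2 / 2) - l * x = - (x\<^sup>2 / (2 * real n * b\<^sup>2))"
    using pos by (simp add: l_def field_simps power2_eq_square)
  finally show ?thesis .
qed

text \<open>
  The maximal inequality for \<open>s\<^sup>2\<close>; the second moment of the full sum is the sum of the second
  moments because the cross terms vanish.
\<close>

lemma maximal_Kolmogorov:
  fixes Y :: "nat \<Rightarrow> 'a \<Rightarrow> real"
  assumes indep: "indep_vars (\<lambda>_. borel) Y {1..n}"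
    and bounded: "\<And>i \<omega>. i \<in> {1..n} \<Longrightarrow> \<omega> \<in> space M \<Longrightarrow> \<bar>Y i \<omega>\<bar> \<le> B"
    and mean: "\<And>i. i \<in> {1..n} \<Longrightarrow> expectation (Y i) = 0"
    and pos: "x > 0"
  shows "prob {\<omega> \<in> space M. \<exists>k\<in>{1..n}. x \<le> \<bar>\<Sum>i=1..k. Y i \<omega>\<bar>}
    \<le> (\<Sum>i=1..n. expectation (\<lambda>\<omega>. (Y i \<omega>)\<^sup>2)) / x\<^sup>2"
proof -
  have meas: "Y i \<in> borel_measurable M" if "i \<in> {1..n}" for i
    using indep that by (auto simp: indep_vars_def)
  have int: "integrable M (Y i)" if "i \<in> {1..n}" for i
    by (rule integrable_const_bound[where B = B]) (use that bounded meas in auto)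
  have int2: "integrable M (\<lambda>\<omega>. (Y i \<omega>)\<^sup>2)" if i: "i \<in> {1..n}" for i
  proof (rule integrable_const_bound[where B = "B\<^sup>2"])
    show "(\<lambda>\<omega>. (Y i \<omega>)\<^sup>2) \<in> borel_measurable M"
      using meas[OF i] by measurable
    show "AE \<omega> in M. norm ((Y i \<omega>)\<^sup>2) \<le> B\<^sup>2"
      using power_mono[OF bounded[OF i] abs_ge_zero, of _ 2] by (intro AE_I2) simp
  qed
  have var: "integrable M (\<lambda>\<omega>. (\<Sum>i=1..k. Y i \<omega>)\<^sup>2) \<and>
      expectation (\<lambda>\<omega>. (\<Sum>i=1..k. Y i \<omega>)\<^sup>2) = (\<Sum>i=1..k. expectation (\<lambda>\<omega>. (Y i \<omega>)\<^sup>2))"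
    if "k \<le> n" for k
    using that
  proof (induction k)
    case (Suc k)
    define h where "h v = (\<Sum>i=1..k. v i)" for v :: "nat \<Rightarrow> real"
    have h: "h \<in> borel_measurable (PiM {1..k} (\<lambda>_. borel))"
      unfolding h_def by (intro borel_measurable_sum measurable_component_singleton) auto
    have h_eq: "h (\<lambda>j\<in>{1..k}. Y j \<omega>) = (\<Sum>i=1..k. Y i \<omega>)" for \<omega>
      unfolding h_def by (rule sum.cong) auto
    have "integrable M (\<lambda>\<omega>. h (\<lambda>j\<in>{1..k}. Y j \<omega>))"
      unfolding h_eq using Suc.prems by (intro Bochner_Integration.integrable_sum int) auto
    note orth = past_orthogonal_to_future[OF indep int mean _ Suc.prems h this, simplified h_eq, simplified]
    have eq: "(\<Sum>i=1..Suc k. Y i \<omega>)\<^sup>2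
      = (\<Sum>i=1..k. Y i \<omega>)\<^sup>2 + 2 * ((\<Sum>i=1..k. Y i \<omega>) * Y (Suc k) \<omega>) + (Y (Suc k) \<omega>)\<^sup>2" for \<omega>
      by (simp add: power2_eq_square algebra_simps)
    show ?case
      unfolding eq using Suc orth int2[of "Suc k"] by simp
  qed simp
  have [measurable]: "(\<lambda>\<omega>. \<Sum>i=1..k. Y i \<omega>) \<in> borel_measurable M" if "k \<in> {1..n}" for k
    by (intro borel_measurable_sum meas) (use that in auto)
  have "x\<^sup>2 * prob {\<omega> \<in> space M. \<exists>k\<in>{1..n}. x\<^sup>2 \<le> (\<Sum>i=1..k. Y i \<omega>)\<^sup>2}
    \<le> expectation (\<lambda>\<omega>. (\<Sum>i=1..n. Y i \<omega>)\<^sup>2)"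
  proof (rule maximal_inequality[OF indep bounded mean, where g = "\<lambda>s. 2 * s"])
    show "s\<^sup>2 + 2 * s * (y - s) \<le> y\<^sup>2" for s y :: real
      using zero_le_power2[of "y - s"] by (simp add: power2_eq_square algebra_simps)
  qed (auto intro!: continuous_intros)
  also have "\<dots> = (\<Sum>i=1..n. expectation (\<lambda>\<omega>. (Y i \<omega>)\<^sup>2))"
    using var by simp
  also have "(\<lambda>s. x\<^sup>2 \<le> s\<^sup>2) = (\<lambda>s. x \<le> \<bar>s\<bar>)"
    using pos by (auto simp: fun_eq_iff simp flip: abs_le_square_iff)
  finally show ?thesis
    using pos by (simp add: field_simps)
qed

lemma prob_UN_le_of_sums:
  fixes A :: "nat \<Rightarrow> 'a set"
  assumes "\<And>j. A j \<in> events" and "\<And>J. (\<Sum>j<J. prob (A j)) \<le> c"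
  shows "prob (\<Union>j. A j) \<le> c"
proof -
  have "summable (\<lambda>j. prob (A j))"
    using assms(2) by (intro summableI_nonneg_bounded) auto
  then have "prob (\<Union>j. A j) \<le> (\<Sum>j. prob (A j))"
    using assms(1) by (intro finite_measure_subadditive_countably) auto
  also have "\<dots> \<le> c"
    using assms(2) by (intro suminf_le_const \<open>summable _\<close>)
  finally show ?thesis .
qed

end

section \<open>Sums of powers and exponentials along dyadic scales\<close>

lemma sum_indices_below_le:
  fixes y :: real
  assumes "y \<ge> 0"
  shows "(\<Sum>i=1..k. if real i < y then 1 else 0) \<le> min (real k) y"
  using assms by (induction k) (auto split: if_splits)

text \<open>
  This bounds \<open>s\<close> times the number of indices up to \<open>k\<close> at which a variable of modulus \<open>s\<close> counts as
  heavy, and so controls the sum of the means of the heavy parts. For \<open>s\<close> above \<open>k powr (1/q)\<close> it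
  holds because \<open>s powr (1 - q)\<close> is decreasing in \<open>s\<close>.
\<close>

lemma times_min_powr_le:
  fixes s q k :: real
  assumes "s \<ge> 0" "k > 0" "q \<ge> 1"
  shows "s * min k (s powr q) \<le> k powr (1 / q) * s powr q"
proof (cases "s \<le> k powr (1 / q)")
  case True
  then show ?thesis
    using assms by (intro mult_mono) auto
next
  case False
  have "0 < k powr (1 / q)"
    using assms by simp
  then have s: "s > 0" "k powr (1 / q) \<le> s"
    using False by linarith+
  have "s * min k (s powr q) \<le> s * k"
    using assms by (intro mult_left_mono) auto
  also have "\<dots> = k * (s powr (1 - q) * s powr q)"
    using s by (simp flip: powr_add)
  also have "\<dots> \<le> k * ((k powr (1 / q)) powr (1 - q) * s powr q)"
    using assms s \<open>0 < k powr (1 / q)\<close> by (intro mult_left_mono mult_right_mono powr_mono2') auto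
  also have "\<dots> = k powr (1 + 1 / q * (1 - q)) * s powr q"
    using assms by (simp add: powr_add powr_powr)
  also have "1 + 1 / q * (1 - q) = 1 / q"
    using assms by (simp add: field_simps)
  finally show ?thesis .
qed

text \<open>
  A convex function lies below its chord, here between \<open>t = 0\<close> and \<open>t = 1\<close>. This estimate is the
  source of the factor \<open>1 / (2 - q)\<close>: the geometric sums below have ratio \<open>2 powr (- t)\<close>.
\<close>

lemma two_powr_gap:
  fixes t :: real
  assumes "0 \<le> t" "t \<le> 1"
  shows "t / 2 \<le> 1 - 2 powr (- t)"
proof -
  have "exp (1 * ((1 - t) *\<^sub>R 0 + t *\<^sub>R (- ln 2))) \<le> (1 - t) * exp (1 * 0) + t * exp (1 * (- ln 2))"
    using assms by (intro convex_onD[OF convex_on_exp]) auto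
  then show ?thesis
    by (simp add: powr_def exp_minus field_simps)
qed

text \<open>
  The summands decay geometrically, and the largest of them is at most \<open>(y/2) powr (- t)\<close>. Capping
  \<open>n powr (- t)\<close> at this value makes the sum telescope, so that the first index with a nonzero
  summand need not be found.
\<close>

lemma dyadic_powr_sum_le:
  fixes t y m :: real
  assumes t: "0 < t" "t \<le> 1" and y: "y > 0" and m: "m > 0"
  shows "(\<Sum>j<J. if y \<le> 2 * (2 ^ j * m) then (2 ^ j * m) powr (- t) else 0) \<le> 4 / t * y powr (- t)"
proof -
  define g where "g n = min ((y / 2) powr (- t)) (n powr (- t))" for n
  have step: "(if y \<le> 2 * n then n powr (- t) else 0) \<le> 2 / t * (g n - g (2 * n))" if n: "n > 0" for n
  proof (cases "y \<le> 2 * n")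
    case True
    have "g n = n powr (- t)" "g (2 * n) = (2 * n) powr (- t)"
      using True n y t by (auto simp: g_def intro!: min_absorb2 powr_mono2')
    then have "g n - g (2 * n) = n powr (- t) * (1 - 2 powr (- t))"
      using n by (simp add: powr_mult algebra_simps)
    moreover have "n powr (- t) * (t / 2) \<le> n powr (- t) * (1 - 2 powr (- t))"
      using t two_powr_gap[of t] by (intro mult_left_mono) auto
    ultimately show ?thesis
      using True t by (simp add: field_simps)
  next
    case False
    have "(2 * n) powr (- t) \<le> n powr (- t)"
      using n t by (intro powr_mono2') auto
    then have "g (2 * n) \<le> g n"
      by (auto simp: g_def)
    then show ?thesis
      using False t by simp
  qed
  have "(\<Sum>j<J. if y \<le> 2 * (2 ^ j * m) then (2 ^ j * m) powr (- t) else 0)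
    \<le> (\<Sum>j<J. 2 / t * (g (2 ^ j * m) - g (2 ^ Suc j * m)))"
    using step[of "2 ^ _ * m"] m by (intro sum_mono) (simp add: mult.assoc)
  also have "\<dots> = 2 / t * (g m - g (2 ^ J * m))"
    using sum_lessThan_telescope'[of "\<lambda>j. g (2 ^ j * m)" J]
    by (subst sum_distrib_left[symmetric]) simp
  also have "\<dots> \<le> 2 / t * (y / 2) powr (- t)"
  proof (intro mult_left_mono)
    have "0 \<le> g (2 ^ J * m)" "g m \<le> (y / 2) powr (- t)"
      by (auto simp: g_def)
    then show "g m - g (2 ^ J * m) \<le> (y / 2) powr (- t)" by linarith
  qed (use t in auto)
  also have "\<dots> = 2 / t * (2 powr t * y powr (- t))"
    using y by (simp add: powr_divide powr_minus field_simps)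
  also have "\<dots> \<le> 2 / t * (2 * y powr (- t))"
    using t powr_mono[of t 1 2] by (intro mult_left_mono mult_right_mono) auto
  finally show ?thesis by simp
qed

text \<open>
  For \<open>p = 2 powr (t * j) \<ge> 1\<close> and \<open>c \<ge> 1\<close> the exponent \<open>2 * p * c\<close> is at least \<open>c + (2 * p - 1)\<close>, and
  \<open>2 * p - 1\<close> is at least \<open>1 + t * j * ln 2\<close>. So \<open>exp (- c)\<close> factors out, with a remainder of at most
  \<open>exp (-1) \<le> 1/2\<close> times a geometric term of ratio \<open>2 powr (- t)\<close>.
\<close>

lemma dyadic_exp_sum_le:
  fixes t c :: real
  assumes t: "0 < t" "t \<le> 1" and c: "c \<ge> 1"
  shows "(\<Sum>j<J. exp (- (2 * 2 powr (t * real j) * c))) \<le> exp (- c) / t"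
proof -
  define r :: real where "r = 2 powr (- t)"
  have r: "0 < r" "t / 2 \<le> 1 - r"
    using t two_powr_gap[of t] by (auto simp: r_def)
  have r_power: "r ^ j = exp (- (t * real j * ln 2))" for j
    by (simp add: r_def powr_def mult_ac flip: exp_of_nat_mult)
  have step: "exp (- (2 * 2 powr (t * real j) * c)) \<le> exp (- c) / 2 * r ^ j" for j
  proof -
    define p where "p = 2 powr (t * real j)"
    have ln2: "0 \<le> t * real j * ln 2"
      using t by simp
    have p: "1 + t * real j * ln 2 \<le> p"
      unfolding p_def powr_def by (simp add: exp_ge_add_one_self)
    have "0 \<le> (2 * p - 1) * (c - 1)"
      using p ln2 c by (intro mult_nonneg_nonneg) auto
    then have "- (2 * p * c) \<le> - c + (- 1) + (- t) * real j * ln 2"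
      using p ln2 by (simp add: algebra_simps)
    then have "exp (- (2 * p * c)) \<le> exp (- c + (- 1) + (- t) * real j * ln 2)"
      by simp
    also have "\<dots> = exp (- c) * exp (- 1) * r ^ j"
      by (simp add: r_power flip: exp_add)
    also have "\<dots> \<le> exp (- c) * (1 / 2) * r ^ j"
      using r exp_ge_add_one_self[of 1]
      by (intro mult_left_mono mult_right_mono) (auto simp: exp_minus field_simps)
    finally show ?thesis by (simp add: p_def)
  qed
  have "(\<Sum>j<J. exp (- (2 * 2 powr (t * real j) * c))) \<le> exp (- c) / 2 * (\<Sum>j<J. r ^ j)"
    using step by (simp add: sum_distrib_left sum_mono)
  also have "(\<Sum>j<J. r ^ j) \<le> 1 / (1 - r)"
    using r t by (subst sum_gp_strict) (auto simp: divide_right_mono)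
  also have "1 / (1 - r) \<le> 1 / (t / 2)"
    using r t by (intro divide_left_mono) auto
  finally show ?thesis
    by (simp add: mult_left_mono)
qed

lemma dyadic_block:
  fixes m k :: nat
  assumes "1 \<le> m" "m \<le> k"
  obtains j where "2 ^ j * m \<le> k" "k \<le> 2 * (2 ^ j * m)"
proof -
  have "k < 2 ^ k * m"
    using less_exp[of k] assms by (metis le_trans mult.right_neutral mult_le_mono2 not_less)
  then have ex: "\<exists>j. k < 2 ^ j * m" ..
  define l where "l = (LEAST j. k < 2 ^ j * m)"
  have l: "k < 2 ^ l * m"
    unfolding l_def using ex by (rule LeastI_ex)
  then have "l \<noteq> 0"
    using assms by (cases l) auto
  then obtain j where j: "l = Suc j"
    by (cases l) auto
  have "\<not> k < 2 ^ j * m"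
    using not_less_Least[of j "\<lambda>j. k < 2 ^ j * m"] j by (simp add: l_def)
  with l j show ?thesis
    by (intro that[of j]) auto
qed

section \<open>Truncation of an i.i.d. sequence\<close>

locale iid_sequence = prob_space +
  fixes X :: "nat \<Rightarrow> 'a \<Rightarrow> real"
  assumes indep: "indep_vars (\<lambda>_. borel) X {1..}"
    and ident: "i \<ge> 1 \<Longrightarrow> distr M borel (X i) = distr M borel (X 1)"
begin

lemma measurable_X [measurable]: "i \<ge> 1 \<Longrightarrow> X i \<in> borel_measurable M"
  using indep by (auto simp: indep_vars_def)

lemma
  fixes \<phi> :: "real \<Rightarrow> real"
  assumes "i \<ge> 1" and [measurable]: "\<phi> \<in> borel_measurable borel"
  shows expectation_ident: "expectation (\<lambda>\<omega>. \<phi> (X i \<omega>)) = expectation (\<lambda>\<omega>. \<phi> (X 1 \<omega>))"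
    and integrable_ident: "integrable M (\<lambda>\<omega>. \<phi> (X i \<omega>)) \<longleftrightarrow> integrable M (\<lambda>\<omega>. \<phi> (X 1 \<omega>))"
proof -
  have [measurable]: "X i \<in> borel_measurable M" "X 1 \<in> borel_measurable M"
    using assms(1) by (auto intro: measurable_X)
  show "expectation (\<lambda>\<omega>. \<phi> (X i \<omega>)) = expectation (\<lambda>\<omega>. \<phi> (X 1 \<omega>))"
    using ident[OF assms(1)] integral_distr[of "X i" M borel \<phi>] integral_distr[of "X 1" M borel \<phi>] by simp
  show "integrable M (\<lambda>\<omega>. \<phi> (X i \<omega>)) \<longleftrightarrow> integrable M (\<lambda>\<omega>. \<phi> (X 1 \<omega>))"
    using ident[OF assms(1)] integrable_distr_eq[of "X i" M borel \<phi>] integrable_distr_eq[of "X 1" M borel \<phi>] by simp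
qed

lemma indep_centred:
  fixes \<psi> :: "nat \<Rightarrow> real \<Rightarrow> real"
  assumes "\<And>i. \<psi> i \<in> borel_measurable borel"
  shows "indep_vars (\<lambda>_. borel) (\<lambda>i \<omega>. \<psi> i (X i \<omega>) - c i) {1..n::nat}"
  by (rule indep_vars_compose2[OF indep_vars_subset[OF indep]])
    (auto intro!: borel_measurable_diff assms)

lemma integrable_bounded:
  fixes \<psi> :: "real \<Rightarrow> real"
  assumes [measurable]: "\<psi> \<in> borel_measurable borel" and "\<And>x. \<bar>\<psi> x\<bar> \<le> b" "i \<ge> 1"
  shows "integrable M (\<lambda>\<omega>. \<psi> (X i \<omega>))"
proof (rule integrable_const_bound[where B = b])
  have [measurable]: "X i \<in> borel_measurable M"
    using assms by (auto intro: measurable_X)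
  show "(\<lambda>\<omega>. \<psi> (X i \<omega>)) \<in> borel_measurable M" by measurable
qed (use assms in auto)

text \<open>
  Centring shifts the interval \<open>[- b, b]\<close> without changing its length, so Hoeffding's bound
  depends on \<open>b\<close> alone.
\<close>

lemma light_tail:
  fixes \<psi> :: "real \<Rightarrow> real"
  assumes \<psi>: "\<psi> \<in> borel_measurable borel" "\<And>x. \<bar>\<psi> x\<bar> \<le> b"
    and pos: "b > 0" "x > 0" "n > 0"
  shows "prob {\<omega> \<in> space M. \<exists>k\<in>{1..n}. x \<le> \<bar>\<Sum>i=1..k. \<psi> (X i \<omega>) - expectation (\<lambda>\<omega>. \<psi> (X 1 \<omega>))\<bar>}
    \<le> 2 * exp (- (x\<^sup>2 / (2 * real n * b\<^sup>2)))"
proof (rule maximal_Hoeffding[where a = "- b - expectation (\<lambda>\<omega>. \<psi> (X 1 \<omega>))"])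
  show "indep_vars (\<lambda>_. borel) (\<lambda>i \<omega>. \<psi> (X i \<omega>) - expectation (\<lambda>\<omega>. \<psi> (X 1 \<omega>))) {1..n}"
    using indep_centred[of "\<lambda>_. \<psi>"] \<psi> by simp
  show "expectation (\<lambda>\<omega>. \<psi> (X i \<omega>) - expectation (\<lambda>\<omega>. \<psi> (X 1 \<omega>))) = 0" if "i \<in> {1..n}" for i
    using integrable_bounded[OF \<psi>, of i] expectation_ident[OF _ \<psi>(1), of i] that by (simp add: prob_space)
  show "\<psi> (X i \<omega>) - expectation (\<lambda>\<omega>. \<psi> (X 1 \<omega>))
      \<in> {- b - expectation (\<lambda>\<omega>. \<psi> (X 1 \<omega>))..- b - expectation (\<lambda>\<omega>. \<psi> (X 1 \<omega>)) + 2 * b}" for i \<omega>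
    using \<psi>(2)[of "X i \<omega>"] by (auto simp: abs_le_iff)
qed (use pos in auto)

text \<open>
  Centring does not increase the second moment. The truncations \<open>\<psi> i\<close> depend on the index, but on
  a dyadic block one dominating function \<open>\<Psi>\<close> serves for all of them.
\<close>

lemma second_moment_tail:
  fixes \<psi> :: "nat \<Rightarrow> real \<Rightarrow> real" and \<Psi> :: "real \<Rightarrow> real"
  assumes \<psi>: "\<And>i. \<psi> i \<in> borel_measurable borel"
    and bound: "\<And>i x. i \<in> {1..n} \<Longrightarrow> \<bar>\<psi> i x\<bar> \<le> b"
    and dom: "\<And>i x. i \<in> {1..n} \<Longrightarrow> (\<psi> i x)\<^sup>2 \<le> \<Psi> x"
    and int: "integrable M (\<lambda>\<omega>. \<Psi> (X 1 \<omega>))"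
    and pos: "x > 0"
  shows "prob {\<omega> \<in> space M. \<exists>k\<in>{1..n}. x \<le> \<bar>\<Sum>i=1..k. \<psi> i (X i \<omega>) - expectation (\<lambda>\<omega>. \<psi> i (X 1 \<omega>))\<bar>}
    \<le> real n * expectation (\<lambda>\<omega>. \<Psi> (X 1 \<omega>)) / x\<^sup>2"
proof -
  define \<mu> where "\<mu> i = expectation (\<lambda>\<omega>. \<psi> i (X 1 \<omega>))" for i
  have int\<psi>: "integrable M (\<lambda>\<omega>. \<psi> i (X l \<omega>))" if "i \<in> {1..n}" "l \<ge> 1" for i l
    using integrable_bounded[OF \<psi> bound] that by blast
  have \<mu>: "\<bar>\<mu> i\<bar> \<le> b" if "i \<in> {1..n}" for i
  proof -
    have "\<bar>\<mu> i\<bar> \<le> expectation (\<lambda>\<omega>. \<bar>\<psi> i (X 1 \<omega>)\<bar>)"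
      unfolding \<mu>_def by (rule integral_abs_bound)
    also have "\<dots> \<le> expectation (\<lambda>\<omega>. b)"
      using int\<psi>[OF that, of 1] bound[OF that] by (intro integral_mono) auto
    finally show ?thesis by (simp add: prob_space)
  qed
  have var: "expectation (\<lambda>\<omega>. (\<psi> i (X i \<omega>) - \<mu> i)\<^sup>2) \<le> expectation (\<lambda>\<omega>. \<Psi> (X 1 \<omega>))" if i: "i \<in> {1..n}" for i
  proof -
    have int2: "integrable M (\<lambda>\<omega>. (\<psi> i (X l \<omega>))\<^sup>2)" if "l \<ge> 1" for l
    proof (rule integrable_bounded[where b = "b\<^sup>2"])
      show "(\<lambda>x. (\<psi> i x)\<^sup>2) \<in> borel_measurable borel"
        using \<psi>[of i] by measurable
      show "\<bar>(\<psi> i x)\<^sup>2\<bar> \<le> b\<^sup>2" for x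
        using power_mono[OF bound[OF i] abs_ge_zero, of x 2] by simp
    qed (use that in auto)
    have mean: "expectation (\<lambda>\<omega>. \<psi> i (X i \<omega>)) = \<mu> i"
      unfolding \<mu>_def using i by (intro expectation_ident \<psi>) auto
    have "expectation (\<lambda>\<omega>. (\<psi> i (X i \<omega>) - \<mu> i)\<^sup>2) = expectation (\<lambda>\<omega>. (\<psi> i (X i \<omega>))\<^sup>2) - (\<mu> i)\<^sup>2"
      using variance_eq[of "\<lambda>\<omega>. \<psi> i (X i \<omega>)"] int\<psi>[OF i, of i] int2[of i] i by (simp add: mean)
    also have "\<dots> \<le> expectation (\<lambda>\<omega>. (\<psi> i (X i \<omega>))\<^sup>2)"
      by simp
    also have "\<dots> = expectation (\<lambda>\<omega>. (\<psi> i (X 1 \<omega>))\<^sup>2)"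
      using i \<psi>[of i] by (intro expectation_ident[of i "\<lambda>x. (\<psi> i x)\<^sup>2"]) auto
    also have "\<dots> \<le> expectation (\<lambda>\<omega>. \<Psi> (X 1 \<omega>))"
      using int2[of 1] int dom[OF i] by (intro integral_mono) auto
    finally show ?thesis .
  qed
  have "prob {\<omega> \<in> space M. \<exists>k\<in>{1..n}. x \<le> \<bar>\<Sum>i=1..k. \<psi> i (X i \<omega>) - \<mu> i\<bar>}
    \<le> (\<Sum>i=1..n. expectation (\<lambda>\<omega>. (\<psi> i (X i \<omega>) - \<mu> i)\<^sup>2)) / x\<^sup>2"
  proof (rule maximal_Kolmogorov[where B = "2 * b"])
    show "indep_vars (\<lambda>_. borel) (\<lambda>i \<omega>. \<psi> i (X i \<omega>) - \<mu> i) {1..n}"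
      by (intro indep_centred \<psi>)
    show "expectation (\<lambda>\<omega>. \<psi> i (X i \<omega>) - \<mu> i) = 0" if "i \<in> {1..n}" for i
      using int\<psi>[OF that, of i] expectation_ident[OF _ \<psi>, of i i] that by (simp add: prob_space \<mu>_def)
    show "\<bar>\<psi> i (X i \<omega>) - \<mu> i\<bar> \<le> 2 * b" if "i \<in> {1..n}" for i \<omega>
      using bound[OF that, of "X i \<omega>"] \<mu>[OF that] by linarith
  qed (rule pos)
  also have "\<dots> \<le> (\<Sum>i=1..n. expectation (\<lambda>\<omega>. \<Psi> (X 1 \<omega>))) / x\<^sup>2"
    using var by (intro divide_right_mono sum_mono) auto
  finally show ?thesis
    by (simp add: \<mu>_def)
qed

text \<open>
  The case \<open>\<epsilon> = 1\<close> for a small truncated moment \<open>u\<close>, by the splitting into a light part \<open>L\<close>, a middle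
  part \<open>W i\<close> and a heavy part \<open>V i\<close>. The number \<open>38\<close> makes the sub-Gaussian exponent on the block
  starting at \<open>n = 2 ^ j * m\<close> at least \<open>38/16\<close>, hence at least \<open>2\<close>, times
  \<open>2 powr (t * j) * m powr (1/q - 1/2)\<close>, as \<open>dyadic_exp_sum_le\<close> requires. The number \<open>129\<close> is
  \<open>128 + 1\<close>, from the middle and the heavy part.
\<close>

lemma normalised_maximal_inequality:
  fixes q \<tau> u :: real and m :: nat
  defines "\<phi> \<equiv> \<lambda>x. if \<tau> \<le> \<bar>x\<bar> powr q then \<bar>x\<bar> powr q else 0"
  assumes q: "1 \<le> q" "q < 2" and m: "m \<ge> 1"
    and \<tau>: "\<tau> > 0" "\<tau> powr (2 / q) \<le> real m powr (1 / q - 1 / 2) / 38"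
    and intX: "integrable M (X 1)" and meanX: "expectation (X 1) = 0"
    and int\<phi>: "integrable M (\<lambda>\<omega>. \<phi> (X 1 \<omega>))"
    and u: "u = expectation (\<lambda>\<omega>. \<phi> (X 1 \<omega>))" "u \<le> 1 / 8"
  shows "prob {\<omega> \<in> space M. \<exists>k\<in>{m..}. 7 / 8 * real k powr (1 / q) < \<bar>\<Sum>i=1..k. X i \<omega>\<bar>}
    \<le> 2 * exp (- (real m powr (1 / q - 1 / 2))) * (q / (2 - q)) + 129 * (q / (2 - q)) * u"
proof -
  define t where "t = 2 / q - 1"
  define a where "a = 1 / q - 1 / 2"
  have t: "0 < t" "t \<le> 1" "2 / q = 1 + t" "t = 2 * a" "q * t = 2 - q" "1 / t = q / (2 - q)"
    using q by (auto simp: t_def a_def field_simps)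
  define L where "L x = (if \<bar>x\<bar> powr q < \<tau> then x else 0)" for x
  define W where "W i x = (if \<tau> \<le> \<bar>x\<bar> powr q \<and> \<bar>x\<bar> powr q \<le> real i then x else 0)" for i :: nat and x
  define V where "V i x = (if \<tau> \<le> \<bar>x\<bar> powr q \<and> real i < \<bar>x\<bar> powr q then x else 0)" for i :: nat and x
  have decomp: "x = L x + W i x + V i x" for x i
    by (auto simp: L_def W_def V_def)
  have meas [measurable]: "L \<in> borel_measurable borel" "W i \<in> borel_measurable borel"
      "V i \<in> borel_measurable borel" "\<phi> \<in> borel_measurable borel" for i
    unfolding L_def W_def V_def \<phi>_def by measurable
  have root: "\<bar>x\<bar> \<le> s powr (1 / q)" if "\<bar>x\<bar> powr q \<le> s" for x s :: real
  proof -
    have "\<bar>x\<bar> = (\<bar>x\<bar> powr q) powr (1 / q)"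
      using q by (simp add: powr_powr)
    also have "\<dots> \<le> s powr (1 / q)"
      using q that by (intro powr_mono2) auto
    finally show ?thesis .
  qed
  have L_bound: "\<bar>L x\<bar> \<le> \<tau> powr (1 / q)" for x
    using root[of x \<tau>] by (auto simp: L_def)
  have W_bound: "\<bar>W i x\<bar> \<le> real i powr (1 / q)" for i x
    using root[of x "real i"] by (auto simp: W_def)
  define \<mu>L where "\<mu>L = expectation (\<lambda>\<omega>. L (X 1 \<omega>))"
  define \<mu>W where "\<mu>W i = expectation (\<lambda>\<omega>. W i (X 1 \<omega>))" for i
  define \<mu>V where "\<mu>V i = expectation (\<lambda>\<omega>. V i (X 1 \<omega>))" for i
  have intL: "integrable M (\<lambda>\<omega>. L (X 1 \<omega>))"
    by (rule integrable_bounded[OF _ L_bound]) auto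
  have intW: "integrable M (\<lambda>\<omega>. W i (X 1 \<omega>))" for i
    by (rule integrable_bounded[OF _ W_bound]) auto
  have V_eq: "V i x = x - L x - W i x" for i x
    using decomp[of x i] by simp
  have intV: "integrable M (\<lambda>\<omega>. V i (X 1 \<omega>))" for i
    unfolding V_eq by (intro Bochner_Integration.integrable_diff intX intL intW)
  have \<mu>: "\<mu>L + \<mu>W i + \<mu>V i = 0" for i
    unfolding \<mu>L_def \<mu>W_def \<mu>V_def V_eq using intX intL intW[of i] meanX by simp
  have \<mu>V: "\<bar>\<Sum>i=1..k. \<mu>V i\<bar> \<le> real k powr (1 / q) * u" if "k \<ge> 1" for k :: nat
  proof -
    have "\<bar>\<Sum>i=1..k. \<mu>V i\<bar> \<le> (\<Sum>i=1..k. \<bar>\<mu>V i\<bar>)"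
      by (rule sum_abs)
    also have "\<dots> \<le> (\<Sum>i=1..k. expectation (\<lambda>\<omega>. \<bar>V i (X 1 \<omega>)\<bar>))"
      unfolding \<mu>V_def by (intro sum_mono integral_abs_bound)
    also have "\<dots> = expectation (\<lambda>\<omega>. \<Sum>i=1..k. \<bar>V i (X 1 \<omega>)\<bar>)"
      by (rule Bochner_Integration.integral_sum[symmetric]) (intro integrable_abs intV)
    also have "\<dots> \<le> expectation (\<lambda>\<omega>. real k powr (1 / q) * \<phi> (X 1 \<omega>))"
    proof (intro integral_mono Bochner_Integration.integrable_sum integrable_abs intV integrable_mult_right int\<phi>)
      fix \<omega>
      define x where "x = X 1 \<omega>"
      show "(\<Sum>i=1..k. \<bar>V i (X 1 \<omega>)\<bar>) \<le> real k powr (1 / q) * \<phi> (X 1 \<omega>)"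
        unfolding x_def[symmetric]
      proof (cases "\<tau> \<le> \<bar>x\<bar> powr q")
        case True
        have "(\<Sum>i=1..k. \<bar>V i x\<bar>) = (\<Sum>i=1..k. \<bar>x\<bar> * (if real i < \<bar>x\<bar> powr q then 1 else 0))"
          using True by (intro sum.cong) (auto simp: V_def)
        also have "\<dots> \<le> \<bar>x\<bar> * min (real k) (\<bar>x\<bar> powr q)"
          unfolding sum_distrib_left[symmetric] by (intro mult_left_mono sum_indices_below_le) auto
        also have "\<dots> \<le> real k powr (1 / q) * \<bar>x\<bar> powr q"
          using that q by (intro times_min_powr_le) auto
        finally show "(\<Sum>i=1..k. \<bar>V i x\<bar>) \<le> real k powr (1 / q) * \<phi> x"
          using True by (simp add: \<phi>_def)
      qed (simp add: V_def \<phi>_def)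
    qed
    finally show ?thesis by (simp add: u(1))
  qed
  define n where "n j = 2 ^ j * m" for j
  have n: "n j \<ge> 1" for j
    using m by (simp add: n_def)
  have n_pos: "real (n j) > 0" for j
    using n[of j] by linarith
  have n_sq: "(real (n j) powr (1 / q))\<^sup>2 = real (n j) * real (n j) powr t" for j
  proof -
    have "(real (n j) powr (1 / q))\<^sup>2 = real (n j) powr (1 / q + 1 / q)"
      by (simp only: power2_eq_square powr_add)
    also have "1 / q + 1 / q = 1 + t"
      using t by simp
    finally show ?thesis
      using n_pos[of j] by (simp add: powr_add)
  qed
  define BL where "BL j = {\<omega> \<in> space M. \<exists>k\<in>{1..2 * n j}.
    1 / 2 * real (n j) powr (1 / q) \<le> \<bar>\<Sum>i=1..k. L (X i \<omega>) - \<mu>L\<bar>}" for j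
  define BW where "BW j = {\<omega> \<in> space M. \<exists>k\<in>{1..2 * n j}.
    1 / 4 * real (n j) powr (1 / q) \<le> \<bar>\<Sum>i=1..k. W i (X i \<omega>) - \<mu>W i\<bar>}" for j
  \<comment> \<open>indices are shifted by one, since the families of events start at \<open>0\<close> and the variables at \<open>1\<close>\<close>
  define BV where "BV i = {\<omega> \<in> space M. \<tau> \<le> \<bar>X (Suc i) \<omega>\<bar> powr q \<and> real (Suc i) < \<bar>X (Suc i) \<omega>\<bar> powr q}" for i
  have sets: "BL j \<in> events" "BW j \<in> events" "BV j \<in> events" for j
  proof -
    have [measurable]: "X (Suc j) \<in> borel_measurable M"
      by (rule measurable_X) simp
    have [measurable]: "(\<lambda>\<omega>. \<Sum>i=1..k. L (X i \<omega>) - \<mu>L) \<in> borel_measurable M" for k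
      by (intro borel_measurable_sum borel_measurable_diff borel_measurable_const
        measurable_compose[OF measurable_X meas(1)]) auto
    have [measurable]: "(\<lambda>\<omega>. \<Sum>i=1..k. W i (X i \<omega>) - \<mu>W i) \<in> borel_measurable M" for k
      by (intro borel_measurable_sum borel_measurable_diff borel_measurable_const
        measurable_compose[OF measurable_X meas(2)]) auto
    show "BL j \<in> events" "BW j \<in> events" "BV j \<in> events"
      unfolding BL_def BW_def BV_def by measurable
  qed
  have "prob (BL j) \<le> 2 * exp (- (2 * 2 powr (t * real j) * real m powr a))" for j
  proof -
    define p where "p = 2 powr (t * real j) * real m powr a"
    define s where "s = \<tau> powr (2 / q)"
    have s: "s > 0" "38 * s \<le> real m powr a"
      using \<tau> by (auto simp: s_def a_def)
    have s_eq: "(\<tau> powr (1 / q))\<^sup>2 = s"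
      using \<tau> by (simp add: s_def power2_eq_square flip: powr_add)
    have "p > 0"
      using m by (simp add: p_def)
    \<comment> \<open>since \<open>t = 2 * a\<close>, a second factor \<open>m powr a\<close> is left to offset the truncation level \<open>s\<close>\<close>
    have "real (n j) powr t = p * real m powr a"
      using m by (simp add: n_def p_def powr_mult powr_powr mult_ac t(4) powr_realpow[symmetric] flip: powr_add)
    then have nt: "p * (38 * s) \<le> real (n j) powr t"
      using s \<open>p > 0\<close> by (simp add: mult_left_mono)
    have "prob (BL j) \<le> 2 * exp (- ((1 / 2 * real (n j) powr (1 / q))\<^sup>2 / (2 * real (2 * n j) * (\<tau> powr (1 / q))\<^sup>2)))"
      unfolding BL_def \<mu>L_def using n[of j] \<tau>(1)
      by (intro light_tail L_bound) auto
    also have "(1 / 2 * real (n j) powr (1 / q))\<^sup>2 / (2 * real (2 * n j) * (\<tau> powr (1 / q))\<^sup>2)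
        = real (n j) powr t / (16 * s)"
      unfolding power_mult_distrib n_sq s_eq using n_pos[of j] by (simp add: field_simps power2_eq_square)
    also have "2 * exp (- (real (n j) powr t / (16 * s))) \<le> 2 * exp (- (2 * p))"
    proof -
      have "2 * p * (16 * s) \<le> p * (38 * s)"
        using s \<open>p > 0\<close> by simp
      then have "2 * p \<le> real (n j) powr t / (16 * s)"
        using nt s by (subst pos_le_divide_eq) auto
      then show ?thesis by simp
    qed
    finally show ?thesis by (simp add: p_def mult.assoc)
  qed
  then have "(\<Sum>j<J. prob (BL j)) \<le> (\<Sum>j<J. 2 * exp (- (2 * 2 powr (t * real j) * real m powr a)))" for J
    by (intro sum_mono)
  also have "(\<Sum>j<J. 2 * exp (- (2 * 2 powr (t * real j) * real m powr a))) \<le> 2 * (exp (- (real m powr a)) / t)" for J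
    unfolding sum_distrib_left[symmetric]
    using t m by (intro mult_left_mono dyadic_exp_sum_le ge_one_powr_ge_zero) auto
  finally have probL: "prob (\<Union>j. BL j) \<le> 2 * (exp (- (real m powr a)) / t)"
    by (intro prob_UN_le_of_sums sets)
  \<comment> \<open>the largest squared truncation on block \<open>j\<close>\<close>
  define \<Psi> where "\<Psi> j x = (if \<tau> \<le> \<bar>x\<bar> powr q \<and> \<bar>x\<bar> powr q \<le> 2 * (2 ^ j * real m) then x\<^sup>2 else 0)" for j :: nat and x
  have \<Psi>_eq: "\<Psi> j x = (W (2 * n j) x)\<^sup>2" for j x
    by (auto simp: \<Psi>_def W_def n_def)
  have int\<Psi>: "integrable M (\<lambda>\<omega>. \<Psi> j (X 1 \<omega>))" for j
  proof (rule integrable_bounded)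
    show "\<bar>\<Psi> j x\<bar> \<le> (real (2 * n j) powr (1 / q))\<^sup>2" for x
      unfolding \<Psi>_eq using power_mono[OF W_bound abs_ge_zero, of "2 * n j" x 2] by simp
  qed (auto simp: \<Psi>_eq)
  have "prob (BW j) \<le> 32 * (real (n j) powr (- t) * expectation (\<lambda>\<omega>. \<Psi> j (X 1 \<omega>)))" for j
  proof -
    have "prob (BW j) \<le> real (2 * n j) * expectation (\<lambda>\<omega>. \<Psi> j (X 1 \<omega>)) / (1 / 4 * real (n j) powr (1 / q))\<^sup>2"
      unfolding BW_def \<mu>W_def
    proof (rule second_moment_tail[where b = "real (2 * n j) powr (1 / q)"])
      show "\<bar>W i x\<bar> \<le> real (2 * n j) powr (1 / q)" if "i \<in> {1..2 * n j}" for i x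
      proof -
        have "real i powr (1 / q) \<le> real (2 * n j) powr (1 / q)"
          using that q by (intro powr_mono2) auto
        then show ?thesis
          using W_bound[of i x] by linarith
      qed
      show "(W i x)\<^sup>2 \<le> \<Psi> j x" if "i \<in> {1..2 * n j}" for i x
        using that unfolding \<Psi>_eq by (auto simp: W_def)
      show "0 < 1 / 4 * real (n j) powr (1 / q)"
        using n_pos[of j] by simp
    qed (use int\<Psi> in auto)
    also have "\<dots> = 32 * (real (n j) powr (- t) * expectation (\<lambda>\<omega>. \<Psi> j (X 1 \<omega>)))"
      unfolding power_mult_distrib n_sq using n_pos[of j] by (simp add: powr_minus field_simps power2_eq_square)
    finally show ?thesis .
  qed
  then have "(\<Sum>j<J. prob (BW j)) \<le> (\<Sum>j<J. 32 * (real (n j) powr (- t) * expectation (\<lambda>\<omega>. \<Psi> j (X 1 \<omega>))))" for J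
    by (intro sum_mono)
  also have "(\<Sum>j<J. 32 * (real (n j) powr (- t) * expectation (\<lambda>\<omega>. \<Psi> j (X 1 \<omega>)))) \<le> 32 * (4 / t * u)" for J
  proof -
    have "(\<Sum>j<J. real (n j) powr (- t) * expectation (\<lambda>\<omega>. \<Psi> j (X 1 \<omega>)))
      = (\<Sum>j<J. expectation (\<lambda>\<omega>. real (n j) powr (- t) * \<Psi> j (X 1 \<omega>)))"
      by simp
    also have "\<dots> = expectation (\<lambda>\<omega>. \<Sum>j<J. real (n j) powr (- t) * \<Psi> j (X 1 \<omega>))"
      by (rule Bochner_Integration.integral_sum[symmetric]) (intro integrable_mult_right int\<Psi>)
    also have "\<dots> \<le> expectation (\<lambda>\<omega>. 4 / t * \<phi> (X 1 \<omega>))"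
    proof (intro integral_mono Bochner_Integration.integrable_sum integrable_mult_right int\<Psi> int\<phi>)
      fix \<omega>
      define x where "x = X 1 \<omega>"
      define y where "y = \<bar>x\<bar> powr q"
      show "(\<Sum>j<J. real (n j) powr (- t) * \<Psi> j (X 1 \<omega>)) \<le> 4 / t * \<phi> (X 1 \<omega>)"
        unfolding x_def[symmetric]
      proof (cases "\<tau> \<le> y")
        case True
        then have y: "y > 0" and x: "\<bar>x\<bar> > 0"
          using \<tau>(1) by (auto simp: y_def)
        have "(\<Sum>j<J. real (n j) powr (- t) * \<Psi> j x)
          = (\<Sum>j<J. if y \<le> 2 * (2 ^ j * real m) then (2 ^ j * real m) powr (- t) else 0) * x\<^sup>2"
          unfolding sum_distrib_right
          by (intro sum.cong refl) (use True in \<open>auto simp: \<Psi>_def y_def n_def\<close>)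
        also have "\<dots> \<le> 4 / t * y powr (- t) * x\<^sup>2"
          using t y m by (intro mult_right_mono dyadic_powr_sum_le) auto
        also have "x\<^sup>2 = \<bar>x\<bar> powr 2"
          using x by simp
        \<comment> \<open>with \<open>y = \<bar>x\<bar> powr q\<close> and \<open>q * t = 2 - q\<close>, the powers of \<open>\<bar>x\<bar>\<close> combine to \<open>\<bar>x\<bar> powr q\<close>\<close>
        also have "4 / t * y powr (- t) * \<bar>x\<bar> powr 2 = 4 / t * \<bar>x\<bar> powr (- (q * t) + 2)"
          by (simp only: y_def powr_powr powr_add) simp
        also have "- (q * t) + 2 = q"
          using t by simp
        finally show "(\<Sum>j<J. real (n j) powr (- t) * \<Psi> j x) \<le> 4 / t * \<phi> x"
          using True by (simp add: \<phi>_def y_def)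
      qed (simp add: \<Psi>_def \<phi>_def y_def)
    qed
    finally show ?thesis
      unfolding sum_distrib_left[symmetric] by (intro mult_left_mono) (simp_all add: u(1))
  qed
  finally have probW: "prob (\<Union>j. BW j) \<le> 32 * (4 / t * u)"
    by (intro prob_UN_le_of_sums sets)
  have "(\<Sum>i<J. prob (BV i)) \<le> u" for J
  proof -
    define e where "e i x = (if \<tau> \<le> \<bar>x\<bar> powr q \<and> real i < \<bar>x\<bar> powr q then 1 else 0 :: real)" for i :: nat and x
    have meas_e: "e i \<in> borel_measurable borel" for i
      unfolding e_def by measurable
    have int_e: "integrable M (\<lambda>\<omega>. e i (X 1 \<omega>))" for i
      by (rule integrable_bounded[where b = 1, OF meas_e]) (auto simp: e_def)
    have "prob (BV i) = expectation (\<lambda>\<omega>. e (Suc i) (X 1 \<omega>))" for i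
    proof -
      have "prob (BV i) = expectation (indicator (BV i))"
        using sets by simp
      also have "\<dots> = expectation (\<lambda>\<omega>. e (Suc i) (X (Suc i) \<omega>))"
        by (intro Bochner_Integration.integral_cong) (auto simp: BV_def e_def indicator_def)
      also have "\<dots> = expectation (\<lambda>\<omega>. e (Suc i) (X 1 \<omega>))"
        by (intro expectation_ident meas_e) simp
      finally show ?thesis .
    qed
    then have "(\<Sum>i<J. prob (BV i)) = (\<Sum>i=1..J. expectation (\<lambda>\<omega>. e i (X 1 \<omega>)))"
      using sum.atLeast1_atMost_eq[of "\<lambda>i. expectation (\<lambda>\<omega>. e i (X 1 \<omega>))" J] by simp
    also have "\<dots> = expectation (\<lambda>\<omega>. \<Sum>i=1..J. e i (X 1 \<omega>))"
      by (rule Bochner_Integration.integral_sum[symmetric]) (rule int_e)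
    also have "\<dots> \<le> expectation (\<lambda>\<omega>. \<phi> (X 1 \<omega>))"
    proof (intro integral_mono Bochner_Integration.integrable_sum int_e int\<phi>)
      fix \<omega>
      show "(\<Sum>i=1..J. e i (X 1 \<omega>)) \<le> \<phi> (X 1 \<omega>)"
        using sum_indices_below_le[of "\<bar>X 1 \<omega>\<bar> powr q" J] by (simp add: e_def \<phi>_def)
    qed
    finally show ?thesis by (simp add: u(1))
  qed
  then have probV: "prob (\<Union>i. BV i) \<le> u"
    by (intro prob_UN_le_of_sums sets)
  have cover: "{\<omega> \<in> space M. \<exists>k\<in>{m..}. 7 / 8 * real k powr (1 / q) < \<bar>\<Sum>i=1..k. X i \<omega>\<bar>}
    \<subseteq> (\<Union>j. BL j) \<union> (\<Union>j. BW j) \<union> (\<Union>i. BV i)"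
  proof (intro subsetI, rule ccontr)
    fix \<omega>
    assume "\<omega> \<in> {\<omega> \<in> space M. \<exists>k\<in>{m..}. 7 / 8 * real k powr (1 / q) < \<bar>\<Sum>i=1..k. X i \<omega>\<bar>}"
      and notin: "\<omega> \<notin> (\<Union>j. BL j) \<union> (\<Union>j. BW j) \<union> (\<Union>i. BV i)"
    then obtain k where \<omega>: "\<omega> \<in> space M" and k: "m \<le> k"
      and large: "7 / 8 * real k powr (1 / q) < \<bar>\<Sum>i=1..k. X i \<omega>\<bar>"
      by auto
    obtain j where j: "n j \<le> k" "k \<le> 2 * n j"
      using dyadic_block[OF m k] unfolding n_def by blast
    have k_block: "k \<in> {1..2 * n j}"
      using j k m by simp
    have "\<omega> \<notin> BL j" "\<omega> \<notin> BW j"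
      using notin by blast+
    then have "\<bar>\<Sum>i=1..k. L (X i \<omega>) - \<mu>L\<bar> < 1 / 2 * real (n j) powr (1 / q)"
      and "\<bar>\<Sum>i=1..k. W i (X i \<omega>) - \<mu>W i\<bar> < 1 / 4 * real (n j) powr (1 / q)"
      unfolding BL_def BW_def mem_Collect_eq using \<omega> k_block not_le by blast+
    moreover have "real (n j) powr (1 / q) \<le> real k powr (1 / q)"
      using q j by (intro powr_mono2) auto
    moreover have "\<bar>\<Sum>i=1..k. \<mu>V i\<bar> \<le> real k powr (1 / q) * (1 / 8)"
      by (rule order_trans[OF \<mu>V mult_left_mono[OF u(2)]]) (use k m in auto)
    moreover have "(\<Sum>i=1..k. X i \<omega>)
      = (\<Sum>i=1..k. L (X i \<omega>) - \<mu>L) + (\<Sum>i=1..k. W i (X i \<omega>) - \<mu>W i) - (\<Sum>i=1..k. \<mu>V i)"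
    proof -
      have "X i \<omega> = (L (X i \<omega>) - \<mu>L) + (W i (X i \<omega>) - \<mu>W i) - \<mu>V i" if "i \<in> {1..k}" for i
      proof -
        have "\<omega> \<notin> BV (i - 1)"
          using notin by blast
        then have "V i (X i \<omega>) = 0"
          using that \<omega> by (auto simp: BV_def V_def)
        then show ?thesis
          using decomp[of "X i \<omega>" i] \<mu>[of i] by linarith
      qed
      then show ?thesis
        unfolding sum.distrib[symmetric] sum_subtractf[symmetric] by (intro sum.cong) auto
    qed
    ultimately show False
      using large by linarith
  qed
  have "prob {\<omega> \<in> space M. \<exists>k\<in>{m..}. 7 / 8 * real k powr (1 / q) < \<bar>\<Sum>i=1..k. X i \<omega>\<bar>}
    \<le> prob ((\<Union>j. BL j) \<union> (\<Union>j. BW j) \<union> (\<Union>i. BV i))"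
    by (intro finite_measure_mono cover) (use sets in auto)
  also have "\<dots> \<le> prob (\<Union>j. BL j) + prob (\<Union>j. BW j) + prob (\<Union>i. BV i)"
    by (intro order_trans[OF measure_Un_le] add_mono order_refl) (use sets in auto)
  also have "\<dots> \<le> 2 * (exp (- (real m powr a)) / t) + 32 * (4 / t * u) + u"
    by (intro add_mono probL probW probV)
  also have "\<dots> \<le> 2 * exp (- (real m powr a)) * (q / (2 - q)) + 129 * (q / (2 - q)) * u"
  proof -
    have "u \<ge> 0"
      unfolding u(1) by (intro integral_nonneg_AE) (auto simp: \<phi>_def)
    moreover have "1 \<le> q / (2 - q)"
      using q by (simp add: field_simps)
    ultimately have "1 * u \<le> q / (2 - q) * u"
      by (intro mult_right_mono)
    then have "u \<le> 1 / t * u"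
      by (simp add: t(6))
    then show ?thesis
      unfolding t(6)[symmetric] by simp
  qed
  finally show ?thesis by (simp add: a_def)
qed

end

section \<open>Truncated moments and scaling\<close>

lemma iid_sequence_scale:
  assumes "iid_sequence M X"
  shows "iid_sequence M (\<lambda>i \<omega>. X i \<omega> / c)"
proof -
  interpret iid_sequence M X by fact
  show ?thesis
  proof
    show "indep_vars (\<lambda>_. borel) (\<lambda>i \<omega>. X i \<omega> / c) {1..}"
      by (rule indep_vars_compose2[OF indep]) measurable
    fix i :: nat assume i: "i \<ge> 1"
    have "distr M borel (\<lambda>\<omega>. X j \<omega> / c) = distr (distr M borel (X j)) borel (\<lambda>x. x / c)" if "j \<ge> 1" for j
      using that by (subst distr_distr) (auto simp: comp_def measurable_X)
    then show "distr M borel (\<lambda>\<omega>. X i \<omega> / c) = distr M borel (\<lambda>\<omega>. X 1 \<omega> / c)"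
      using ident[OF i] i by simp
  qed
qed

lemma tail_moment_scale:
  assumes [measurable]: "Y \<in> borel_measurable M" and c: "c > 0"
  shows "tail_moment M Y q (c powr q * x) = ennreal (c powr q) * tail_moment M (\<lambda>\<omega>. Y \<omega> / c) q x"
proof -
  have "tail_moment M Y q (c powr q * x)
    = (\<integral>\<^sup>+ \<omega>. ennreal (c powr q) * (ennreal (\<bar>Y \<omega> / c\<bar> powr q) * indicator {\<omega> \<in> space M. \<bar>Y \<omega> / c\<bar> powr q \<ge> x} \<omega>) \<partial>M)"
    unfolding tail_moment_def
  proof (intro nn_integral_cong)
    fix \<omega>
    have "\<bar>Y \<omega>\<bar> powr q = c powr q * \<bar>Y \<omega> / c\<bar> powr q"
      using c by (simp add: abs_divide powr_divide)
    then show "ennreal (\<bar>Y \<omega>\<bar> powr q) * indicator {\<omega> \<in> space M. c powr q * x \<le> \<bar>Y \<omega>\<bar> powr q} \<omega>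
      = ennreal (c powr q) * (ennreal (\<bar>Y \<omega> / c\<bar> powr q) * indicator {\<omega> \<in> space M. \<bar>Y \<omega> / c\<bar> powr q \<ge> x} \<omega>)"
      using c by (simp add: indicator_def ennreal_mult)
  qed
  then show ?thesis
    unfolding tail_moment_def by (simp add: nn_integral_cmult)
qed

lemma tail_moment_finite:
  fixes q x :: real
  defines "\<phi> \<equiv> \<lambda>y. if x \<le> \<bar>y\<bar> powr q then \<bar>y\<bar> powr q else 0"
  assumes [measurable]: "Y \<in> borel_measurable M" and fin: "tail_moment M Y q x < \<infinity>"
  shows "integrable M (\<lambda>\<omega>. \<phi> (Y \<omega>))"
    and "tail_moment M Y q x = ennreal (\<integral> \<omega>. \<phi> (Y \<omega>) \<partial>M)"
proof -
  have [measurable]: "\<phi> \<in> borel_measurable borel"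
    unfolding \<phi>_def by measurable
  have eq: "tail_moment M Y q x = (\<integral>\<^sup>+ \<omega>. ennreal (\<phi> (Y \<omega>)) \<partial>M)"
    unfolding tail_moment_def by (intro nn_integral_cong) (auto simp: \<phi>_def indicator_def)
  have nonneg: "0 \<le> \<phi> y" for y
    by (simp add: \<phi>_def)
  show int: "integrable M (\<lambda>\<omega>. \<phi> (Y \<omega>))"
    using fin nonneg by (intro integrableI_nonneg) (auto simp: eq)
  show "tail_moment M Y q x = ennreal (\<integral> \<omega>. \<phi> (Y \<omega>) \<partial>M)"
    unfolding eq using int nonneg by (intro nn_integral_eq_integral) auto
qed

text \<open>
  The factor \<open>\<epsilon> powr q\<close> that scaling produces is absorbed by the denominator \<open>min (\<epsilon>\<^sup>2) 1\<close>.
\<close>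

lemma square_min_one_le_powr:
  fixes \<epsilon> q :: real
  assumes "\<epsilon> > 0" "1 \<le> q" "q < 2"
  shows "min (\<epsilon>\<^sup>2) 1 \<le> \<epsilon> powr q"
proof (cases "\<epsilon> \<ge> 1")
  case True
  then show ?thesis
    using assms ge_one_powr_ge_zero[of \<epsilon> q] by simp
next
  case False
  then have "\<epsilon> powr 2 \<le> \<epsilon> powr q"
    using assms by (intro powr_mono') auto
  then show ?thesis
    using assms by simp
qed

section \<open>The deviation bound for normalised partial sums\<close>

theorem theorem2p3:
  fixes M :: "'a measure" and X :: "nat \<Rightarrow> 'a \<Rightarrow> real"
    and S :: "nat \<Rightarrow> 'a \<Rightarrow> real" and U :: "real \<Rightarrow> ennreal"
    and q \<epsilon> :: real and m :: nat
  defines "S \<equiv> \<lambda>n \<omega>. \<Sum>i=1..n. X i \<omega>"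
    and "U \<equiv> \<lambda>x. tail_moment M (X 1) q x"
  assumes "prob_space M"
    and "prob_space.indep_vars M (\<lambda>_. borel) X {1..}"
    and "\<And>i. i \<ge> 1 \<Longrightarrow> distr M borel (X i) = distr M borel (X 1)"
    and "\<And>i. i \<ge> 1 \<Longrightarrow> integrable M (X i)"
    and "prob_space.expectation M (X 1) = 0"
    and "1 \<le> q" and "q < 2"
    and "\<epsilon> > 0" and "m \<ge> 1"
  shows "emeasure M {\<omega> \<in> space M.
            (SUP k\<in>{m..}. ereal (\<bar>S k \<omega>\<bar> / real k powr (1 / q))) \<ge> ereal \<epsilon>}
         \<le> ennreal (4 * exp (- (real m powr (1 / q - 1 / 2))) / (2 - q))
           + ennreal (451 * q / (min (\<epsilon>\<^sup>2) 1 * (2 - q)))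
             * U (\<epsilon> powr q * (real m powr (1 / 2 - q / 4) / 38))"
proof -
  interpret X: iid_sequence M X
    by (intro iid_sequence.intro iid_sequence_axioms.intro assms)
  define Z where "Z i \<omega> = X i \<omega> / \<epsilon>" for i \<omega>
  interpret Z: iid_sequence M Z
    unfolding Z_def by (rule iid_sequence_scale) unfold_locales
  define \<tau> where "\<tau> = real m powr (1 / 2 - q / 4) / 38"
  define T where "T = tail_moment M (Z 1) q \<tau>"
  define A where "A = 4 * exp (- (real m powr (1 / q - 1 / 2))) / (2 - q)"
  define C where "C = 451 * (q / (2 - q))"
  define E where "E = {\<omega> \<in> space M. \<exists>k\<in>{m..}. 7 / 8 * real k powr (1 / q) < \<bar>\<Sum>i=1..k. Z i \<omega>\<bar>}"
  note q = \<open>1 \<le> q\<close> \<open>q < 2\<close> and \<epsilon> = \<open>\<epsilon> > 0\<close> and m = \<open>m \<ge> 1\<close>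
  have qq: "1 \<le> q / (2 - q)"
    using q by (simp add: field_simps)
  have [measurable]: "X 1 \<in> borel_measurable M" "Z 1 \<in> borel_measurable M"
    by (auto intro: X.measurable_X Z.measurable_X)
  have [measurable]: "(\<lambda>\<omega>. \<Sum>i=1..k. Z i \<omega>) \<in> borel_measurable M" for k
    by (intro borel_measurable_sum Z.measurable_X) auto
  have "{\<omega> \<in> space M. (SUP k\<in>{m..}. ereal (\<bar>S k \<omega>\<bar> / real k powr (1 / q))) \<ge> ereal \<epsilon>} \<subseteq> E"
  proof
    fix \<omega> assume *: "\<omega> \<in> {\<omega> \<in> space M. (SUP k\<in>{m..}. ereal (\<bar>S k \<omega>\<bar> / real k powr (1 / q))) \<ge> ereal \<epsilon>}"
    \<comment> \<open>the supremum need not be attained, so an index is chosen where a smaller level is exceeded\<close>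
    have "ereal (7 / 8 * \<epsilon>) < ereal \<epsilon>"
      using \<epsilon> by simp
    also have "\<dots> \<le> (SUP k\<in>{m..}. ereal (\<bar>S k \<omega>\<bar> / real k powr (1 / q)))"
      using * by simp
    finally obtain k where k: "k \<ge> m" "7 / 8 * \<epsilon> < \<bar>S k \<omega>\<bar> / real k powr (1 / q)"
      by (auto simp: less_SUP_iff)
    have "real k powr (1 / q) > 0"
      using k m by simp
    then have "7 / 8 * real k powr (1 / q) < \<bar>S k \<omega>\<bar> / \<epsilon>"
      using k(2) \<epsilon> by (simp add: pos_less_divide_eq mult_ac)
    also have "\<bar>S k \<omega>\<bar> / \<epsilon> = \<bar>\<Sum>i=1..k. Z i \<omega>\<bar>"
      using \<epsilon> by (simp add: S_def Z_def flip: sum_divide_distrib)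
    finally show "\<omega> \<in> E"
      using * k(1) by (auto simp: E_def)
  qed
  then have "emeasure M {\<omega> \<in> space M. (SUP k\<in>{m..}. ereal (\<bar>S k \<omega>\<bar> / real k powr (1 / q))) \<ge> ereal \<epsilon>}
    \<le> emeasure M E"
    by (rule emeasure_mono) (simp add: E_def)
  also have "\<dots> \<le> ennreal A + ennreal C * T"
  proof (cases "T \<le> ennreal (1 / 8)")
    case True
    define u where "u = X.expectation (\<lambda>\<omega>. if \<tau> \<le> \<bar>Z 1 \<omega>\<bar> powr q then \<bar>Z 1 \<omega>\<bar> powr q else 0)"
    have fin: "tail_moment M (Z 1) q \<tau> < \<infinity>"
      using True by (auto simp: T_def intro: le_less_trans)
    have T: "T = ennreal u"
      unfolding T_def u_def by (rule tail_moment_finite(2)[OF _ fin]) measurable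
    have u0: "u \<ge> 0"
      unfolding u_def by (intro integral_nonneg_AE) auto
    have "\<tau> powr (2 / q) \<le> real m powr (1 / q - 1 / 2) / 38"
    proof -
      have "\<tau> powr (2 / q) = real m powr ((1 / 2 - q / 4) * (2 / q)) / 38 powr (2 / q)"
        unfolding \<tau>_def by (simp add: powr_divide powr_powr)
      also have "(1 / 2 - q / 4) * (2 / q) = 1 / q - 1 / 2"
        using q by (simp add: field_simps)
      also have "real m powr (1 / q - 1 / 2) / 38 powr (2 / q) \<le> real m powr (1 / q - 1 / 2) / 38"
        using q powr_mono[of 1 "2 / q" 38] by (intro divide_left_mono) auto
      finally show ?thesis .
    qed
    moreover have "\<tau> > 0"
      using m by (simp add: \<tau>_def)
    moreover have "integrable M (Z 1)" "X.expectation (Z 1) = 0"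
      using assms(6)[of 1] assms(7) by (simp_all add: Z_def[abs_def])
    moreover have "u \<le> 1 / 8"
      using True u0 by (simp add: T)
    ultimately have "X.prob E \<le> 2 * exp (- (real m powr (1 / q - 1 / 2))) * (q / (2 - q)) + 129 * (q / (2 - q)) * u"
      unfolding E_def using q m
      by (intro Z.normalised_maximal_inequality[where \<tau> = \<tau>] tail_moment_finite(1)[OF _ fin] u_def) auto
    also have "\<dots> \<le> A + C * u"
    proof (rule add_mono)
      have "2 * exp (- (real m powr (1 / q - 1 / 2))) * q \<le> 2 * exp (- (real m powr (1 / q - 1 / 2))) * 2"
        using q by (intro mult_left_mono) auto
      then show "2 * exp (- (real m powr (1 / q - 1 / 2))) * (q / (2 - q)) \<le> A"
        using q by (simp add: A_def divide_right_mono)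
      show "129 * (q / (2 - q)) * u \<le> C * u"
        using u0 qq by (intro mult_right_mono) (auto simp: C_def)
    qed
    finally have "ennreal (X.prob E) \<le> ennreal (A + C * u)"
      by (rule ennreal_leI)
    also have "\<dots> = ennreal A + ennreal C * T"
    proof -
      have "0 \<le> A" "0 \<le> C"
        using q by (simp_all add: A_def C_def)
      then show ?thesis
        using u0 by (simp add: T ennreal_plus ennreal_mult)
    qed
    finally show ?thesis
      by (simp add: X.emeasure_eq_measure)
  next
    case False
    \<comment> \<open>the bound is at least \<open>1\<close>, because \<open>451 / 8 \<ge> 1\<close>\<close>
    have "emeasure M E \<le> 1"
      by (rule X.emeasure_le_1)
    also have "1 \<le> ennreal (C * (1 / 8))"
    proof -
      have "451 * 1 \<le> C"
        unfolding C_def by (rule mult_left_mono[OF qq]) simp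
      then have "1 \<le> C * (1 / 8)"
        by linarith
      then show ?thesis
        using ennreal_leI[of 1 "C * (1 / 8)"] by simp
    qed
    also have "\<dots> = ennreal C * ennreal (1 / 8)"
      using qq by (intro ennreal_mult) (auto simp: C_def)
    also have "\<dots> \<le> ennreal C * T"
      using False by (intro mult_left_mono) auto
    also have "\<dots> \<le> ennreal A + ennreal C * T"
      by simp
    finally show ?thesis .
  qed
  also have "ennreal A + ennreal C * T
    \<le> ennreal A + ennreal (451 * q / (min (\<epsilon>\<^sup>2) 1 * (2 - q))) * (ennreal (\<epsilon> powr q) * T)"
  proof -
    have pos: "min (\<epsilon>\<^sup>2) 1 > 0"
      using \<epsilon> by simp
    have "C * 1 \<le> C * (\<epsilon> powr q / min (\<epsilon>\<^sup>2) 1)"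
      using qq pos square_min_one_le_powr[OF \<epsilon> q] by (intro mult_left_mono) (auto simp: C_def pos_le_divide_eq)
    also have "\<dots> = 451 * q / (min (\<epsilon>\<^sup>2) 1 * (2 - q)) * \<epsilon> powr q"
      by (simp add: C_def)
    finally have "ennreal C \<le> ennreal (451 * q / (min (\<epsilon>\<^sup>2) 1 * (2 - q))) * ennreal (\<epsilon> powr q)"
      using q pos by (subst ennreal_mult[symmetric]) (auto intro: ennreal_leI)
    then show ?thesis
      unfolding mult.assoc[symmetric] by (intro add_left_mono mult_right_mono) auto
  qed
  also have "ennreal (\<epsilon> powr q) * T = U (\<epsilon> powr q * \<tau>)"
    unfolding T_def U_def Z_def by (rule tail_moment_scale[symmetric, OF _ \<epsilon>]) measurable
  finally show ?thesis
    by (simp add: A_def \<tau>_def)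
qed

end
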